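(* Let $q$ be a prime power, $r\geqslant 1$, and let $p$ be the characteristic of $\mathbb{F}_{q^r}$. Let $d\geqslant3$ be an integer with $d\equiv d_0\pmod p$ for some integer $d_0\in[2,p-1]$. Then every polynomial $f(X)\in\mathbb{F}_{q^r}[X]$ of degree $d$ belongs to $\mathcal{F}_d(q)$.
   Context: $\mathcal{F}_d(q)$ is the set of rational functions $f(X)\in\mathbb{F}_{q^r}(X)$ of degree $d$ such that for every $\omega\in\mathbb{F}_{q^r}^*$ the function $f(X+\omega)-f(X)$ is not of the form $\alpha(g(X)^p-g(X))+\beta X$ for any rational function $g(X)\in\overline{\mathbb{F}_q}(X)$ and any $\alpha,\beta\in\mathbb{F}_{q^r}$; here $\overline{\mathbb{F}_q}$ is the algebraic closure of $\mathbb{F}_q$. *)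

theory Defs
  imports
    "HOL-Algebra.Algebraic_Closure_Type"
    "HOL-Library.Cardinality"
    "HOL-Number_Theory.Prime_Powers"
    "HOL-Number_Theory.Cong"
begin

text \<open>
  Rational functions over a field are elements of the type \<open>'a poly fract\<close>, and
  \<^const>\<open>to_fract\<close> embeds the polynomials into them.  For a field \<open>'a\<close> with \<open>q ^ r\<close> elements,
  \<open>'a alg_closure\<close> is an algebraic closure of \<open>'a\<close>, hence also of its subfield with \<open>q\<close> elements.
\<close>

text \<open>
  The library makes \<open>'a poly\<close> a GCD ring only if \<open>'a\<close> itself is one, so the degree of a rational
  function is phrased with \<^const>\<open>coprime\<close> instead of \<^term>\<open>quot_of_fract\<close>.  It is well defined by
  \<open>coprime_Fract_cases\<close> and \<open>ratfun_degree_Fract\<close>.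
\<close>

definition ratfun_degree :: "'a :: field poly fract \<Rightarrow> nat" where
  "ratfun_degree f =
     (THE n. \<exists>a b. coprime a b \<and> b \<noteq> 0 \<and> f = Fract a b \<and> n = max (degree a) (degree b))"

lemma field_poly_bezout:
  fixes a b :: "'a :: field poly"
  shows "\<exists>u v. (u * a + v * b) dvd a \<and> (u * a + v * b) dvd b"
proof (induction "euclidean_size b" arbitrary: a b rule: less_induct)
  case less
  show ?case
  proof (cases "b = 0")
    case True
    then show ?thesis
      by (intro exI[of _ 1] exI[of _ 0]) simp
  next
    case False
    obtain u v where uv: "(u * b + v * (a mod b)) dvd b" "(u * b + v * (a mod b)) dvd (a mod b)"
      using less[OF mod_size_less[OF False]] by blast
    have "u * b + v * (a mod b) = u * b + v * (a - a div b * b)"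
      by (simp only: minus_div_mult_eq_mod)
    also have "\<dots> = v * a + (u - v * (a div b)) * b"
      by (simp only: algebra_simps)
    finally have eq: "u * b + v * (a mod b) = v * a + (u - v * (a div b)) * b" .
    have "(u * b + v * (a mod b)) dvd a"
      using uv dvd_mod_imp_dvd by blast
    with uv(1) show ?thesis
      by (intro exI[of _ v] exI[of _ "u - v * (a div b)"] conjI) (simp_all only: eq)
  qed
qed

lemma field_poly_coprime_dvd_mult:
  fixes a b c :: "'a :: field poly"
  assumes "coprime a b" and "b dvd a * c"
  shows "b dvd c"
proof -
  obtain u v where uv: "(u * a + v * b) dvd a" "(u * a + v * b) dvd b"
    using field_poly_bezout by blast
  then have "(u * a + v * b) dvd 1"
    using assms(1) by (auto dest: coprime_common_divisor)
  then obtain w where w: "1 = (u * a + v * b) * w" ..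
  have "c = (u * a + v * b) * w * c"
    by (simp flip: w)
  also have "\<dots> = u * w * (a * c) + b * (v * w * c)"
    by (simp add: algebra_simps)
  finally have eq: "u * w * (a * c) + b * (v * w * c) = c"
    by (rule sym)
  have "b dvd u * w * (a * c) + b * (v * w * c)"
    by (intro dvd_add dvd_mult[OF assms(2)] dvd_triv_left)
  then show ?thesis
    by (simp only: eq)
qed

lemma coprime_Fract_cases:
  fixes f :: "'a :: field poly fract"
  obtains a b where "coprime a b" and "b \<noteq> 0" and "f = Fract a b"
proof -
  obtain a b where f: "f = Fract a b" "b \<noteq> 0"
    by (cases f)
  obtain u v where uv: "(u * a + v * b) dvd a" "(u * a + v * b) dvd b"
    using field_poly_bezout by blast
  define d where "d = u * a + v * b"
  obtain a' b' where ab: "a = d * a'" "b = d * b'"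
    using uv unfolding d_def[symmetric] dvd_def by blast
  have "d \<noteq> 0" "b' \<noteq> 0"
    using f ab by auto
  have "d * (u * a' + v * b') = u * (d * a') + v * (d * b')"
    by (simp only: distrib_left mult.left_commute)
  then have "d * (u * a' + v * b') = d"
    by (simp only: ab [symmetric] d_def [symmetric])
  then have *: "u * a' + v * b' = 1"
    using \<open>d \<noteq> 0\<close> by simp
  have "coprime a' b'"
    by (rule coprimeI) (metis * dvd_add dvd_mult)
  moreover have "f = Fract a' b'"
    using \<open>d \<noteq> 0\<close> \<open>b' \<noteq> 0\<close> unfolding f(1) ab by (simp add: eq_fract mult_ac)
  ultimately show ?thesis
    using that \<open>b' \<noteq> 0\<close> by blast
qed

lemma ratfun_degree_Fract:
  fixes a b :: "'a :: field poly"
  assumes "coprime a b" and "b \<noteq> 0"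
  shows "ratfun_degree (Fract a b) = max (degree a) (degree b)"
  unfolding ratfun_degree_def
proof (rule the_equality)
  show "\<exists>a' b'. coprime a' b' \<and> b' \<noteq> 0 \<and> Fract a b = Fract a' b' \<and>
          max (degree a) (degree b) = max (degree a') (degree b')"
    using assms by blast
next
  fix n
  assume "\<exists>a' b'. coprime a' b' \<and> b' \<noteq> 0 \<and> Fract a b = Fract a' b' \<and>
            n = max (degree a') (degree b')"
  then obtain a' b' where *: "coprime a' b'" "b' \<noteq> 0" "Fract a b = Fract a' b'"
    and n: "n = max (degree a') (degree b')"
    by blast
  have eq: "a * b' = a' * b"
    using * assms by (simp add: eq_fract)
  have "b dvd a * b'"
    by (simp add: eq)
  then have 1: "b dvd b'"
    using assms(1) field_poly_coprime_dvd_mult by blast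
  have "b' dvd a' * b"
    by (simp flip: eq)
  then have 2: "b' dvd b"
    using *(1) field_poly_coprime_dvd_mult by blast
  have db: "degree b = degree b'"
    using 1 2 assms(2) *(2) by (simp add: dvd_imp_degree_le order_antisym)
  have "a = 0 \<longleftrightarrow> a' = 0"
    using eq assms(2) *(2) by auto
  moreover have "degree a = degree a'" if "a \<noteq> 0" "a' \<noteq> 0"
    using arg_cong[OF eq, of degree] that assms(2) *(2) db by (simp add: degree_mult_eq)
  ultimately have "degree a = degree a'"
    by (cases "a = 0") simp_all
  with db n show "n = max (degree a) (degree b)"
    by simp
qed

lemma ratfun_degree_to_fract: "ratfun_degree (to_fract f) = degree (f :: 'a :: field poly)"
  using ratfun_degree_Fract[of f 1] unfolding to_fract_def by simp

text \<open>
  The map on fraction fields induced by an injective ring homomorphism, \<open>a / b \<mapsto> h a / h b\<close>;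
  by \<open>map_fract_Fract\<close> the value does not depend on the representative \<open>a / b\<close>.
\<close>

definition map_fract :: "('a :: idom \<Rightarrow> 'b :: idom) \<Rightarrow> 'a fract \<Rightarrow> 'b fract" where
  "map_fract h x = (THE y. \<exists>a b. b \<noteq> 0 \<and> x = Fract a b \<and> y = Fract (h a) (h b))"

lemma map_fract_Fract:
  assumes "\<And>a b. h (a * b) = h a * h b" and "\<And>a. h a = 0 \<longleftrightarrow> a = 0" and "b \<noteq> 0"
  shows "map_fract h (Fract a b) = Fract (h a) (h b)"
  unfolding map_fract_def
proof (rule the_equality)
  show "\<exists>a' b'. b' \<noteq> 0 \<and> Fract a b = Fract a' b' \<and> Fract (h a) (h b) = Fract (h a') (h b')"
    using assms(3) by blast
next
  fix y
  assume "\<exists>a' b'. b' \<noteq> 0 \<and> Fract a b = Fract a' b' \<and> y = Fract (h a') (h b')"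
  then obtain a' b' where *: "b' \<noteq> 0" "Fract a b = Fract a' b'" and y: "y = Fract (h a') (h b')"
    by blast
  have "a * b' = a' * b"
    using * assms(3) by (simp add: eq_fract)
  then have "h a * h b' = h a' * h b"
    by (metis assms(1))
  then show "y = Fract (h a) (h b)"
    using * assms(2,3) y by (simp add: eq_fract)
qed

text \<open>The substitution \<open>f(X) \<mapsto> f(X + \<omega>)\<close>.\<close>

definition ratfun_shift :: "'a :: field \<Rightarrow> 'a poly fract \<Rightarrow> 'a poly fract" where
  "ratfun_shift \<omega> = map_fract (\<lambda>a. pcompose a [:\<omega>, 1:])"

lemma ratfun_shift_Fract:
  "b \<noteq> 0 \<Longrightarrow> ratfun_shift \<omega> (Fract a b) = Fract (pcompose a [:\<omega>, 1:]) (pcompose b [:\<omega>, 1:])"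
  unfolding ratfun_shift_def by (rule map_fract_Fract) (simp_all add: pcompose_mult pcompose_eq_0_iff)

text \<open>The inclusion of the rational functions over \<open>'a\<close> into those over its algebraic closure.\<close>

definition ratfun_to_ac :: "'a :: field poly fract \<Rightarrow> 'a alg_closure poly fract" where
  "ratfun_to_ac = map_fract (map_poly to_ac)"

lemma map_poly_to_ac_mult:
  "map_poly to_ac (a * b) = map_poly to_ac a * (map_poly to_ac b :: 'a :: field alg_closure poly)"
  by (intro poly_eqI) (simp add: coeff_map_poly coeff_mult to_ac_sum)

lemma ratfun_to_ac_Fract:
  "b \<noteq> 0 \<Longrightarrow> ratfun_to_ac (Fract a b) = Fract (map_poly to_ac a) (map_poly to_ac b)"
  unfolding ratfun_to_ac_def
  by (rule map_fract_Fract) (simp_all add: map_poly_to_ac_mult map_poly_eq_0_iff)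

text \<open>
  The set \<open>\<F>\<^sub>d(q)\<close> for the field \<open>'a\<close> with \<open>q ^ r\<close> elements: the parameters \<open>q\<close> and \<open>r\<close> enter
  only through the type \<open>'a\<close>.
\<close>

definition F_set :: "nat \<Rightarrow> 'a :: finite_field poly fract set" where
  "F_set d = {f. ratfun_degree f = d \<and>
     (\<forall>\<omega>. \<omega> \<noteq> 0 \<longrightarrow>
        \<not> (\<exists>(g :: 'a alg_closure poly fract) (\<alpha> :: 'a) (\<beta> :: 'a).
             ratfun_to_ac (ratfun_shift \<omega> f - f) =
               to_fract [:to_ac \<alpha>:] * (g ^ CHAR('a) - g) + to_fract [:0, to_ac \<beta>:]))}"

end

theory Submission
  imports Defs
begin

text \<open>
  For \<open>\<omega> \<noteq> 0\<close> the difference \<open>f(X + \<omega>) - f(X)\<close> has degree \<open>d - 1\<close>, because \<open>p\<close> does not divide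
  \<open>d\<close>, and \<open>d - 1 \<ge> 2\<close>, so subtracting \<open>\<beta> X\<close> does not change its degree.  A polynomial of positive
  degree of the form \<open>\<alpha> (g\<^sup>p - g)\<close> with \<open>g\<close> rational has degree divisible by \<open>p\<close>, whereas \<open>p\<close> does
  not divide \<open>d - 1\<close>.
\<close>

text \<open>Allowing every \<open>n\<close> from the degree upwards covers in one statement both the
  cancellation of leading terms in f(X + w) - f(X) and the vanishing of all higher ones.\<close>

lemma coeff_pcompose_shift_top:
  fixes f :: "'a :: comm_ring_1 poly"
  assumes "degree f \<le> n"
  shows "coeff (pcompose f [:w, 1:]) n = coeff f n"
  using assms
proof (induction f arbitrary: n)
  case 0
  then show ?case by simp
next
  case (pCons c f)
  show ?case
  proof (cases "f = 0")
    case False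
    with pCons.prems obtain m where m: "n = Suc m" "degree f \<le> m"
      by (cases n) auto
    then show ?thesis
      using pCons.IH[of m] pCons.IH[of "Suc m"]
      by (simp add: pcompose_pCons coeff_eq_0)
  qed (auto simp: pcompose_pCons)
qed

text \<open>The extra term is the linear term in \<open>w\<close> of the binomial expansion of (X +
  w)^(n + 1). The induction follows Horner's scheme: f = c + X f1 becomes c + (X + w) f1(X +
  w).\<close>

lemma coeff_pcompose_shift_second:
  fixes f :: "'a :: comm_ring_1 poly"
  assumes "degree f \<le> Suc n"
  shows "coeff (pcompose f [:w, 1:]) n = coeff f n + of_nat (Suc n) * w * coeff f (Suc n)"
  using assms
proof (induction f arbitrary: n)
  case 0
  then show ?case by simp
next
  case (pCons c f)
  have deg: "degree f \<le> n"
    using pCons.prems by (cases "f = 0") auto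
  note top = coeff_pcompose_shift_top[OF deg, of w]
  show ?case
  proof (cases n)
    case 0
    with top show ?thesis by (simp add: pcompose_pCons)
  next
    case (Suc m)
    with top pCons.IH[of m] deg show ?thesis
      by (simp add: pcompose_pCons algebra_simps)
  qed
qed

lemma degree_pcompose_shift_diff:
  fixes f :: "'a :: idom poly"
  assumes "degree f = Suc n" and "w \<noteq> 0" and "of_nat (Suc n) \<noteq> (0 :: 'a)"
  shows "degree (pcompose f [:w, 1:] - f) = n"
proof (rule antisym)
  show "degree (pcompose f [:w, 1:] - f) \<le> n"
    using assms(1) by (intro degree_le) (auto simp: coeff_pcompose_shift_top)
  have "coeff f (Suc n) \<noteq> 0"
    using assms(1) by (metis coeff_0_degree_minus_1 degree_0 leading_coeff_0_iff nat.distinct(1))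
  then have "coeff (pcompose f [:w, 1:] - f) n \<noteq> 0"
    using assms coeff_pcompose_shift_second[of f n w] by (simp del: of_nat_Suc)
  then show "n \<le> degree (pcompose f [:w, 1:] - f)"
    by (rule le_degree)
qed

text \<open>This is c = g^p - g for g = a/b, with denominators cleared. A pole of g at infinity is
  forced, so a^p dominates the left side and deg c = p (deg a - deg b).\<close>

lemma dvd_degree_Artin_Schreier:
  fixes a b c :: "'a :: idom poly"
  assumes "b \<noteq> 0" and "p > 1" and "degree c > 0" and eq: "a ^ p - a * b ^ (p - 1) = c * b ^ p"
  shows "p dvd degree c"
proof -
  have c: "c \<noteq> 0" using assms(3) by auto
  have rhs: "degree (c * b ^ p) = degree c + p * degree b"
    using c assms(1) by (simp add: degree_mult_eq degree_power_eq)
  \<comment> \<open>Otherwise the left side has degree at most p deg b, which the right side exceeds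
    by deg c > 0.\<close>
  have less: "degree b < degree a"
  proof (rule ccontr)
    assume "\<not> degree b < degree a"
    then have le: "degree a \<le> degree b" by simp
    have "degree (a ^ p) \<le> p * degree b"
      using degree_power_le[of a p] mult_le_mono1[OF le, of p] by (metis mult.commute order_trans)
    moreover have "degree (a * b ^ (p - 1)) \<le> p * degree b"
    proof -
      have "degree (a * b ^ (p - 1)) \<le> degree a + degree b * (p - 1)"
        using degree_mult_le[of a "b ^ (p - 1)"] degree_power_le[of b "p - 1"] by linarith
      also have "\<dots> \<le> degree b + degree b * (p - 1)" using le by simp
      also have "\<dots> = p * degree b" using assms(2) by (cases p) auto
      finally show ?thesis .
    qed
    ultimately have "degree (c * b ^ p) \<le> p * degree b"
      unfolding eq[symmetric] by (rule degree_diff_le)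
    with rhs assms(3) show False by simp
  qed
  then have a: "a \<noteq> 0" by auto
  have "degree (a * b ^ (p - 1)) = degree a + (p - 1) * degree b"
    using a assms(1) by (simp add: degree_mult_eq degree_power_eq)
  also have "\<dots> < degree a + (p - 1) * degree a" using less assms(2) by simp
  also have "\<dots> = p * degree a" using assms(2) by (cases p) auto
  also have "\<dots> = degree (a ^ p)" using a by (simp add: degree_power_eq)
  finally have "degree (a ^ p - a * b ^ (p - 1)) = degree (a ^ p)"
    using degree_add_eq_left[of "- (a * b ^ (p - 1))" "a ^ p"] by simp
  then have "degree c + p * degree b = p * degree a"
    using rhs eq a by (simp add: degree_power_eq)
  then show ?thesis
    by (metis dvd_add_left_iff dvd_triv_left)
qed

lemma Fract_power: "b \<noteq> 0 \<Longrightarrow> Fract a b ^ n = Fract (a ^ n) (b ^ n)"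
  by (induction n) (simp_all add: One_fract_def)

text \<open>Since deg h > 1, removing \<beta> X keeps the degree; the result is nonzero, so \<alpha>
  is invertible and can be divided out, leaving a polynomial \<open>k\<close> equal to g^p -
  g.\<close>

lemma dvd_degree_of_ratfun_Artin_Schreier:
  fixes g :: "'a :: field poly fract" and h :: "'a poly"
  assumes "p > 1" and "degree h > 1"
    and eq: "to_fract h = to_fract [:\<alpha>:] * (g ^ p - g) + to_fract [:0, \<beta>:]"
  shows "p dvd degree h"
proof -
  define c where "c = h - [:0, \<beta>:]"
  have "degree [:0, \<beta>:] < degree h" using assms(2) by (auto simp: degree_pCons_eq_if)
  then have degc: "degree c = degree h"
    unfolding c_def diff_conv_add_uminus by (intro degree_add_eq_left) (simp only: degree_minus)
  have c: "to_fract c = to_fract [:\<alpha>:] * (g ^ p - g)"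
    unfolding c_def using eq by (simp add: to_fract_diff)
  have "\<alpha> \<noteq> 0"
  proof
    assume "\<alpha> = 0"
    with c have "c = 0" by simp
    with degc assms(2) show False by simp
  qed
  define k where "k = [:inverse \<alpha>:] * c"
  have degk: "degree k = degree h"
    using \<open>\<alpha> \<noteq> 0\<close> degc by (simp add: k_def)
  have "to_fract k = to_fract ([:inverse \<alpha>:] * [:\<alpha>:]) * (g ^ p - g)"
    unfolding k_def to_fract_mult c by (simp only: mult.assoc)
  also have "[:inverse \<alpha>:] * [:\<alpha>:] = 1"
    using \<open>\<alpha> \<noteq> 0\<close> by (simp add: one_pCons)
  finally have k: "to_fract k = g ^ p - g" by simp
  obtain a b where g: "g = Fract a b" "b \<noteq> 0" by (cases g)
  obtain m where m: "p = Suc m" using assms(1) by (cases p) auto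
  \<comment> \<open>Subtraction of fractions yields the denominator b^p b; its surplus factor b is
    cancelled below.\<close>
  have "Fract k 1 = Fract (a ^ p * b - a * b ^ p) (b ^ p * b)"
    using k g by (simp add: to_fract_def Fract_power)
  then have "k * (b ^ p * b) = a ^ p * b - a * b ^ p"
    using g by (simp add: eq_fract)
  then have "b * (k * b ^ p) = b * (a ^ p - a * b ^ (p - 1))"
    by (simp add: m algebra_simps)
  then have "a ^ p - a * b ^ (p - 1) = k * b ^ p"
    using g by (simp only: mult_cancel_left) simp
  from dvd_degree_Artin_Schreier[OF g(2) assms(1) _ this] show ?thesis
    using degk assms(2) by simp
qed

theorem theorem2p9:
  fixes q r p d :: nat and f :: "'a :: finite_field poly"
  assumes "primepow q" and "r \<ge> 1" and "CARD('a) = q ^ r" and "p = CHAR('a)"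
    and "d \<ge> 3" and "\<exists>d\<^sub>0 \<in> {2..p - 1}. [d = d\<^sub>0] (mod p)"
    and "degree f = d"
  shows "to_fract f \<in> (F_set d :: 'a poly fract set)"
proof -
  obtain d0 where d0: "2 \<le> d0" "d0 \<le> p - 1" "[d = d0] (mod p)"
    using assms(6) by auto
  then have p: "p > 1" and dmod: "d mod p = d0" by (auto simp: cong_def)
  obtain n where n: "d = Suc n" using assms(5) by (cases d) auto
  \<comment> \<open>The residue \<open>d0\<close> of d is neither 0 nor 1, so p divides neither d
    nor n = d - 1.\<close>
  have nd: "\<not> p dvd Suc n" using dmod d0 n by (auto simp: dvd_eq_mod_eq_0)
  have "\<not> p dvd n"
  proof
    assume "p dvd n"
    then have "Suc n mod p = Suc 0 mod p" by (simp add: mod_Suc_eq[of n p, symmetric] dvd_eq_mod_eq_0)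
    with dmod n d0 p show False by simp
  qed
  moreover have "p dvd n"
    if "\<omega> \<noteq> 0"
      and "ratfun_to_ac (ratfun_shift \<omega> (to_fract f) - to_fract f) =
        to_fract [:to_ac \<alpha>:] * (g ^ CHAR('a) - g) + to_fract [:0, to_ac \<beta>:]"
    for \<omega> \<alpha> \<beta> :: 'a and g :: "'a alg_closure poly fract"
  proof -
    define h where "h = pcompose f [:\<omega>, 1:] - f"
    have "of_nat (Suc n) \<noteq> (0 :: 'a)"
      using nd assms(4) by (simp only: of_nat_eq_0_iff_char_dvd) simp
    then have degh: "degree h = n"
      unfolding h_def using degree_pcompose_shift_diff assms(7) n that(1) by blast
    have "ratfun_shift \<omega> (to_fract f) - to_fract f = Fract h 1"
      by (simp add: h_def to_fract_def ratfun_shift_Fract pcompose_1)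
    then have "to_fract (map_poly to_ac h) =
        to_fract [:to_ac \<alpha>:] * (g ^ p - g) + to_fract [:0, to_ac \<beta>:]"
      using that(2) assms(4) by (simp add: ratfun_to_ac_Fract to_fract_def)
    \<comment> \<open>The embedding \<open>to_ac\<close> sends the nonzero leading coefficient to a
      nonzero one.\<close>
    moreover have "degree (map_poly to_ac h :: 'a alg_closure poly) = n"
      using degh by (simp add: degree_map_poly)
    moreover have "n > 1" using assms(5) n by simp
    ultimately show ?thesis
      using dvd_degree_of_ratfun_Artin_Schreier[OF p, of "map_poly to_ac h"] by simp
  qed
  ultimately show ?thesis
    using assms(7) unfolding F_set_def by (auto simp: ratfun_degree_to_fract)
qed

end
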